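(* Let $\theta : \mathbb{Z} \to Aut(\mathbb{Q}^2)$ be a homomorphism and let $M \in GL_2(\mathbb{Q})$ be the matrix of $\theta(1)$. Then the Reidemeister spectrum of $\mathbb{Q}^2 \rtimes_\theta \mathbb{Z}$ is either $\{\infty\}$ or $\{2\} \cup \{\infty\}$. More precisely, $Spec(\mathbb{Q}^2 \rtimes_\theta \mathbb{Z}) = \{\infty\}$ if there is no invertible $2 \times 2$ matrix $N$ over $\mathbb{Q}$ such that $N = MNM$, $\det(Id - N) \neq 0$ and $\det(Id - MN) \neq 0$; otherwise $Spec(\mathbb{Q}^2 \rtimes_\theta \mathbb{Z}) = \{2\} \cup \{\infty\}$.
   Context: For an automorphism $\phi$ of a group $G$, the Reidemeister (twisted conjugacy) classes of $\phi$ are the equivalence classes of the relation $x \sim g x \phi(g^{-1})$, $x, g \in G$, and the Reidemeister number $R(\phi)$ is the number of these classes (a positive integer or $\infty$). The Reidemeister spectrum is $Spec(G) = \{R(\phi) \mid \phi \in Aut(G)\} \subseteq \mathbb{N} \cup \{\infty\}$. $\mathbb{Q}^2$ is regarded as an additive group; its automorphisms are exactly the $\mathbb{Q}$-linear ones. $\mathbb{Q}^2 \rtimes_\theta \mathbb{Z}$ is the semidirect product in which the generator $1 \in \mathbb{Z}$ acts on $\mathbb{Q}^2$ by $\theta(1)$. $Id$ is the identity matrix. *)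

theory Defs
  imports
    "HOL-Algebra.Bij"
    "HOL-Algebra.Elementary_Groups"
    "HOL-Analysis.Determinants"
    "HOL-Library.Extended_Nat"
begin

definition additive_group :: "'a::ab_group_add monoid"
  where "additive_group = \<lparr>carrier = UNIV, monoid.mult = (+), one = 0\<rparr>"

lemma group_additive_group: "group additive_group"
  unfolding additive_group_def
  by (rule groupI) (auto simp: add.assoc intro: exI [of _ "- x" for x])

text \<open>In the product below, conjugation by \<open>(\<one>, k)\<close> maps \<open>(h, \<one>)\<close> to \<open>(\<theta> k h, \<one>)\<close>.\<close>

definition semidirect_product ::
    "('a, 'c) monoid_scheme \<Rightarrow> ('b, 'd) monoid_scheme \<Rightarrow> ('b \<Rightarrow> 'a \<Rightarrow> 'a) \<Rightarrow> ('a \<times> 'b) monoid"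
  where "semidirect_product H K \<theta> =
    \<lparr>carrier = carrier H \<times> carrier K,
     monoid.mult = (\<lambda>(a, k) (b, l). (a \<otimes>\<^bsub>H\<^esub> \<theta> k b, k \<otimes>\<^bsub>K\<^esub> l)),
     one = (\<one>\<^bsub>H\<^esub>, \<one>\<^bsub>K\<^esub>)\<rparr>"

lemma group_semidirect_product:
  assumes H: "group H" and K: "group K" and \<theta>: "\<theta> \<in> hom K (AutoGroup H)"
  shows "group (semidirect_product H K \<theta>)"
proof -
  interpret H: group H by (rule H)
  interpret K: group K by (rule K)
  interpret A: group "AutoGroup H" by (rule H.AutoGroup)
  have aut: "\<theta> k \<in> auto H" if "k \<in> carrier K" for k
    using hom_carrier [OF \<theta>] that by (auto simp: AutoGroup_def)
  have hm: "\<theta> k \<in> hom H H" and bij: "bij_betw (\<theta> k) (carrier H) (carrier H)"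
    if "k \<in> carrier K" for k
    using aut [OF that] by (auto simp: auto_def Bij_def)
  have cl: "\<theta> k a \<in> carrier H" if "k \<in> carrier K" "a \<in> carrier H" for k a
    using hm that by (auto simp: hom_def)
  have add: "\<theta> k (a \<otimes>\<^bsub>H\<^esub> b) = \<theta> k a \<otimes>\<^bsub>H\<^esub> \<theta> k b"
    if "k \<in> carrier K" "a \<in> carrier H" "b \<in> carrier H" for k a b
    using hm that by (auto simp: hom_def)
  have comp: "\<theta> (k \<otimes>\<^bsub>K\<^esub> l) a = \<theta> k (\<theta> l a)"
    if "k \<in> carrier K" "l \<in> carrier K" "a \<in> carrier H" for k l a
    using hom_mult [OF \<theta> that(1,2)] aut [OF that(1)] aut [OF that(2)] that(3)
    by (simp add: AutoGroup_def BijGroup_def auto_def compose_def)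
  have one: "\<theta> \<one>\<^bsub>K\<^esub> a = a" if "a \<in> carrier H" for a
  proof -
    have "\<theta> \<one>\<^bsub>K\<^esub> (\<theta> \<one>\<^bsub>K\<^esub> a) = \<theta> \<one>\<^bsub>K\<^esub> a"
      using comp [of "\<one>\<^bsub>K\<^esub>" "\<one>\<^bsub>K\<^esub>" a] that by simp
    then show ?thesis
      using bij [OF K.one_closed] cl [OF K.one_closed that] that
      by (meson bij_betw_imp_inj_on inj_onD)
  qed
  show ?thesis
  proof (rule groupI)
    fix x assume "x \<in> carrier (semidirect_product H K \<theta>)"
    then obtain a k where x: "x = (a, k)" and a: "a \<in> carrier H" and k: "k \<in> carrier K"
      by (auto simp: semidirect_product_def)
    let ?y = "(\<theta> (inv\<^bsub>K\<^esub> k) (inv\<^bsub>H\<^esub> a), inv\<^bsub>K\<^esub> k)"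
    have "\<theta> (inv\<^bsub>K\<^esub> k) (inv\<^bsub>H\<^esub> a) \<otimes>\<^bsub>H\<^esub> \<theta> (inv\<^bsub>K\<^esub> k) a = \<theta> (inv\<^bsub>K\<^esub> k) \<one>\<^bsub>H\<^esub>"
      using add [of "inv\<^bsub>K\<^esub> k" "inv\<^bsub>H\<^esub> a" a] a k by simp
    also have "\<dots> = \<one>\<^bsub>H\<^esub>"
      using hom_one [OF hm H H, of "inv\<^bsub>K\<^esub> k"] k by simp
    finally show "\<exists>y\<in>carrier (semidirect_product H K \<theta>).
        y \<otimes>\<^bsub>semidirect_product H K \<theta>\<^esub> x = \<one>\<^bsub>semidirect_product H K \<theta>\<^esub>"
      using a k cl by (intro bexI [of _ ?y]) (auto simp: semidirect_product_def x)
  qed (auto simp: semidirect_product_def cl add comp one H.m_assoc K.m_assoc)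
qed

definition twisted_conjugacy :: "('a, 'b) monoid_scheme \<Rightarrow> ('a \<Rightarrow> 'a) \<Rightarrow> ('a \<times> 'a) set"
  where "twisted_conjugacy G \<phi> =
    {(x, y). x \<in> carrier G \<and> y \<in> carrier G \<and>
       (\<exists>g\<in>carrier G. y = g \<otimes>\<^bsub>G\<^esub> x \<otimes>\<^bsub>G\<^esub> \<phi> (inv\<^bsub>G\<^esub> g))}"

definition reidemeister_classes :: "('a, 'b) monoid_scheme \<Rightarrow> ('a \<Rightarrow> 'a) \<Rightarrow> 'a set set"
  where "reidemeister_classes G \<phi> = carrier G // twisted_conjugacy G \<phi>"

definition reidemeister_number :: "('a, 'b) monoid_scheme \<Rightarrow> ('a \<Rightarrow> 'a) \<Rightarrow> enat"
  where "reidemeister_number G \<phi> =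
    (if finite (reidemeister_classes G \<phi>) then enat (card (reidemeister_classes G \<phi>)) else \<infinity>)"

definition reidemeister_spectrum :: "('a, 'b) monoid_scheme \<Rightarrow> enat set"
  where "reidemeister_spectrum G = {reidemeister_number G \<phi> | \<phi>. \<phi> \<in> auto G}"

end

theory Submission
  imports Defs
begin

text \<open>
  Every automorphism \<open>\<phi>\<close> of \<open>\<rat>\<^sup>n \<rtimes> \<int>\<close> maps the divisible group \<open>\<rat>\<^sup>n\<close> to itself, say by a matrix \<open>N\<close>, and
  acts on the quotient \<open>\<int>\<close> by a sign. If the sign is \<open>1\<close>, twisted conjugacy preserves the \<open>\<int>\<close>-coordinate
  and there are infinitely many classes. If it is \<open>-1\<close>, then \<open>N = M N M\<close>, twisted conjugacy preserves the
  parity of the \<open>\<int>\<close>-coordinate, and the classes over \<open>k \<in> {0, 1}\<close> are the elements of the cokernel of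
  \<open>Id - M\<^sup>k N\<close>, a rational vector space: it has one element if the determinant is nonzero and infinitely
  many otherwise. Conversely, such an \<open>N\<close> defines the automorphism \<open>(v, k) \<mapsto> (N v, -k)\<close>.
\<close>

section \<open>Additive maps and singular matrices over the rationals\<close>

text \<open>Additivity gives integer scaling; for a rational scalar, multiplying by the denominator
  reduces to integers, and this multiplication can be cancelled coordinatewise.\<close>

lemma additive_rat_linear:
  fixes f :: "rat^'n \<Rightarrow> rat^'m"
  assumes add: "\<And>x y. f (x + y) = f x + f y"
  shows "Vector_Spaces.linear (*s) (*s) f"
proof -
  interpret additive f
    by standard (rule add)
  have nat: "f (of_nat n *s x) = of_nat n *s f x" for n x
    by (induction n) (simp_all add: zero add vec.scale_left_distrib)
  have int: "f (of_int z *s x) = of_int z *s f x" for z x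
  proof (cases z rule: int_cases2)
    case (nonneg n)
    then show ?thesis
      using nat [of n x] by simp
  next
    case (nonpos n)
    then show ?thesis
      using nat [of n x] by (simp add: minus vector_sneg_minus1 [symmetric])
  qed
  have scale: "f (q *s x) = q *s f x" for q x
  proof -
    obtain a b where q: "q = of_int a / of_int b" and b: "b > 0"
      by (metis quotient_of_denom_pos quotient_of_div surj_pair)
    have "of_int b *s f (q *s x) = f (of_int a *s x)"
      using b by (simp add: int [symmetric] q)
    also have "\<dots> = of_int b *s (q *s f x)"
      using b by (simp add: int q)
    finally show ?thesis
      using b by (simp add: vec_eq_iff)
  qed
  show ?thesis
    by unfold_locales (simp_all add: add scale)
qed

text \<open>Divisibility of the domain: every positive \<open>n\<close> divides \<open>f x\<close>,
  because \<open>x\<close> is \<open>n\<close> times another vector. An integer with arbitrarily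
  large divisors is zero.\<close>

lemma additive_rat_int_zero:
  fixes f :: "rat^'n \<Rightarrow> int"
  assumes add: "\<And>x y. f (x + y) = f x + f y"
  shows "f x = 0"
proof -
  interpret additive f
    by standard (rule add)
  have mult: "f (of_nat n *s y) = int n * f y" for n y
    by (induction n) (simp_all add: zero add vec.scale_left_distrib algebra_simps)
  \<comment> \<open>The successor makes \<open>n\<close> positive, hence invertible in the
    rationals, and strictly larger than the absolute value of \<open>f x\<close>.\<close>
  define n where "n = Suc (nat \<bar>f x\<bar>)"
  have "of_nat n *s (inverse (of_nat n) *s x) = x"
    by (simp add: n_def del: of_nat_Suc)
  then have "int n dvd f x"
    using mult [of n "inverse (of_nat n) *s x"] by simp
  moreover have "\<bar>f x\<bar> < int n"
    by (simp add: n_def)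
  ultimately show ?thesis
    using zdvd_not_zless [of "\<bar>f x\<bar>" "int n"] by force
qed

text \<open>A kernel vector \<open>c\<close> of the transpose gives a nonzero linear functional that
  vanishes on the image of \<open>A\<close>. It later serves as an invariant separating infinitely
  many classes.\<close>

lemma singular_matrix_left_kernel:
  fixes A :: "'a::field^'n^'n"
  assumes "det A = 0"
  obtains c where "c \<noteq> 0" "\<And>x. (\<Sum>i\<in>UNIV. c $ i * (A *v x) $ i) = 0"
proof -
  have "\<not> invertible (transpose A)"
    using assms by (simp add: invertible_det_nz det_transpose)
  then obtain c where c: "c \<noteq> 0" "transpose A *v c = 0"
    by (auto simp: invertible_left_inverse matrix_left_invertible_ker)
  have "(\<Sum>i\<in>UNIV. c $ i * (A *v x) $ i) = (\<Sum>j\<in>UNIV. (transpose A *v c) $ j * x $ j)" for x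
    unfolding matrix_vector_mult_def transpose_def
    by (simp add: sum_distrib_left sum_distrib_right, subst sum.swap)
       (simp add: ac_simps)
  then show thesis
    using that c by simp
qed

section \<open>Invariants and the orbit relation of twisted conjugacy\<close>

lemma infinite_quotient:
  assumes "B \<subseteq> A" and inf: "infinite (f ` B)"
    and refl: "\<And>x. x \<in> B \<Longrightarrow> (x, x) \<in> r"
    and resp: "\<And>x y. x \<in> B \<Longrightarrow> y \<in> B \<Longrightarrow> (x, y) \<in> r \<Longrightarrow> f x = f y"
  shows "infinite (A // r)"
proof
  assume fin: "finite (A // r)"
  have "f ` B \<subseteq> (\<lambda>X. the_elem (f ` (X \<inter> B))) ` (A // r)"
  proof
    fix z
    assume "z \<in> f ` B"
    then obtain x where x: "x \<in> B" "z = f x"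
      by blast
    then have "x \<in> r `` {x} \<inter> B"
      using refl by simp
    moreover have "f ` (r `` {x} \<inter> B) \<subseteq> {f x}"
    proof (rule image_subsetI)
      fix y
      assume "y \<in> r `` {x} \<inter> B"
      then show "f y \<in> {f x}"
        using resp [of x y] x(1) by simp
    qed
    ultimately have "f ` (r `` {x} \<inter> B) = {f x}"
      by blast
    moreover have "r `` {x} \<in> A // r"
      using x assms(1) by (auto simp: quotient_def)
    ultimately show "z \<in> (\<lambda>X. the_elem (f ` (X \<inter> B))) ` (A // r)"
      using x by (metis (no_types, lifting) image_eqI the_elem_eq)
  qed
  then show False
    using inf fin finite_surj by blast
qed

text \<open>This is the orbit relation of the action of \<open>g\<close> by
  \<open>x \<mapsto> g \<otimes> x \<otimes> \<phi> (inv g)\<close>: inverses give symmetry and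
  products give transitivity.\<close>

lemma (in group) equiv_twisted_conjugacy:
  assumes \<phi>: "\<phi> \<in> hom G G"
  shows "equiv (carrier G) (twisted_conjugacy G \<phi>)"
proof -
  have cl: "\<phi> x \<in> carrier G" if "x \<in> carrier G" for x
    using \<phi> that by (auto simp: hom_def)
  have mult: "\<phi> (x \<otimes> y) = \<phi> x \<otimes> \<phi> y" if "x \<in> carrier G" "y \<in> carrier G" for x y
    using \<phi> that by (auto simp: hom_def)
  have one: "\<phi> \<one> = \<one>"
    using hom_one [OF \<phi>] is_group by blast
  show ?thesis
  proof (rule equivI)
    show "twisted_conjugacy G \<phi> \<subseteq> carrier G \<times> carrier G"
      by (auto simp: twisted_conjugacy_def)
    show "refl_on (carrier G) (twisted_conjugacy G \<phi>)"
      by (auto simp: refl_on_def twisted_conjugacy_def one intro!: bexI [of _ \<one>])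
    show "sym (twisted_conjugacy G \<phi>)"
    proof (rule symI)
      fix x y
      assume "(x, y) \<in> twisted_conjugacy G \<phi>"
      then obtain g where xy: "x \<in> carrier G" "y \<in> carrier G" "g \<in> carrier G"
        and y: "y = g \<otimes> x \<otimes> \<phi> (inv g)"
        by (auto simp: twisted_conjugacy_def)
      have "inv g \<otimes> y \<otimes> \<phi> (inv (inv g)) = (inv g \<otimes> g) \<otimes> x \<otimes> (\<phi> (inv g) \<otimes> \<phi> g)"
        using xy by (simp only: y m_assoc inv_closed inv_inv m_closed cl)
      also have "\<dots> = x"
        using xy by (simp add: mult [symmetric] one)
      finally show "(y, x) \<in> twisted_conjugacy G \<phi>"
        using xy by (auto simp: twisted_conjugacy_def intro!: bexI [of _ "inv g"])
    qed
    show "trans (twisted_conjugacy G \<phi>)"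
    proof (rule transI)
      fix x y z
      assume "(x, y) \<in> twisted_conjugacy G \<phi>" "(y, z) \<in> twisted_conjugacy G \<phi>"
      then obtain g h where xy: "x \<in> carrier G" "y \<in> carrier G" "z \<in> carrier G"
          "g \<in> carrier G" "h \<in> carrier G"
        and y: "y = g \<otimes> x \<otimes> \<phi> (inv g)" and z: "z = h \<otimes> y \<otimes> \<phi> (inv h)"
        by (auto simp: twisted_conjugacy_def)
      have "z = (h \<otimes> g) \<otimes> x \<otimes> \<phi> (inv (h \<otimes> g))"
        using xy by (simp add: y z m_assoc cl inv_mult_group mult)
      then show "(x, z) \<in> twisted_conjugacy G \<phi>"
        using xy by (auto simp: twisted_conjugacy_def)
    qed
  qed
qed

section \<open>The semidirect product in arbitrary finite dimension\<close>

locale rat_by_int =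
  fixes \<theta> :: "int \<Rightarrow> rat^'n \<Rightarrow> rat^'n" and M :: "rat^'n^'n"
  assumes \<theta>: "\<theta> \<in> hom integer_group (AutoGroup additive_group)"
    and M: "M = matrix (\<theta> 1)"
begin

abbreviation "G \<equiv> semidirect_product additive_group integer_group \<theta>"

lemma carrier_G [simp]: "carrier G = UNIV"
  by (simp add: semidirect_product_def additive_group_def)

lemma one_G [simp]: "\<one>\<^bsub>G\<^esub> = (0, 0)"
  by (simp add: semidirect_product_def additive_group_def)

lemma mult_G [simp]: "(a, k) \<otimes>\<^bsub>G\<^esub> (b, l) = (a + \<theta> k b, k + l)"
  by (simp add: semidirect_product_def additive_group_def)

sublocale G: group G
  by (rule group_semidirect_product [OF group_additive_group group_integer_group \<theta>])

lemma \<theta>_auto: "\<theta> k \<in> auto additive_group"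
  using hom_carrier [OF \<theta>] by (auto simp: AutoGroup_def)

lemma \<theta>_add: "\<theta> k (a + b) = \<theta> k a + \<theta> k b"
  using \<theta>_auto [of k] by (simp add: auto_def hom_def additive_group_def)

lemma \<theta>_linear: "Vector_Spaces.linear (*s) (*s) (\<theta> k)"
  by (rule additive_rat_linear) (rule \<theta>_add)

lemma \<theta>_zero [simp]: "\<theta> k 0 = 0"
  using \<theta>_add [of k 0 0] by simp

lemma \<theta>_comp: "\<theta> k (\<theta> l a) = \<theta> (k + l) a"
  using hom_mult [OF \<theta>, of k l] \<theta>_auto [of k] \<theta>_auto [of l]
  by (simp add: AutoGroup_def BijGroup_def auto_def compose_def additive_group_def)

lemma \<theta>_0 [simp]: "\<theta> 0 a = a"
proof -
  \<comment> \<open>\<open>\<theta> 0\<close> is idempotent by \<open>\<theta>_comp\<close>, and an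
    injective idempotent map is the identity.\<close>
  have "inj (\<theta> 0)"
    using \<theta>_auto [of 0] by (simp add: auto_def Bij_def additive_group_def bij_betw_def)
  then show ?thesis
    using \<theta>_comp [of 0 0 a] by (simp add: inj_def)
qed

lemma matrix_\<theta>_0 [simp]: "matrix (\<theta> 0) = mat 1"
  by (simp add: matrix_eq matrix_works [OF \<theta>_linear])

lemma \<theta>_1: "\<theta> 1 a = M *v a"
  by (simp add: M matrix_works [OF \<theta>_linear])

lemma inv_G [simp]: "inv\<^bsub>G\<^esub> (a, k) = (\<theta> (- k) (- a), - k)"
  by (rule G.inv_equality) (simp_all add: \<theta>_add [symmetric])

section \<open>The shape of automorphisms\<close>

text \<open>The second coordinate of \<open>\<phi>\<close> is a homomorphism to the integers. It
  kills the divisible part, so it is multiplication by some \<open>\<epsilon>\<close>, and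
  surjectivity makes \<open>\<epsilon>\<close> a unit. The matrix \<open>N\<close> is the
  restriction of \<open>\<phi>\<close> to the divisible part.\<close>

lemma auto_shape:
  assumes "\<phi> \<in> auto G"
  obtains N w \<epsilon> where "invertible N" "\<epsilon> = 1 \<or> \<epsilon> = -1"
    "\<And>v k. snd (\<phi> (v, k)) = \<epsilon> * k" "\<And>v. \<phi> (v, 0) = (N *v v, 0)"
    "\<phi> (0, 1) = (w, \<epsilon>)"
proof -
  have mult: "\<phi> (x \<otimes>\<^bsub>G\<^esub> y) = \<phi> x \<otimes>\<^bsub>G\<^esub> \<phi> y" for x y
    using assms by (auto simp: auto_def intro: hom_mult)
  have surj: "surj \<phi>"
    using assms by (simp add: auto_def Bij_def bij_betw_def)
  have snd_mult: "snd (\<phi> (x \<otimes>\<^bsub>G\<^esub> y)) = snd (\<phi> x) + snd (\<phi> y)" for x y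
    by (cases "\<phi> x"; cases "\<phi> y") (simp add: mult)
  have snd0: "snd (\<phi> (v, 0)) = 0" for v
    by (rule additive_rat_int_zero [where f = "\<lambda>v. snd (\<phi> (v, 0))"])
       (use snd_mult [of "(_, 0)" "(_, 0)"] in simp)
  define \<epsilon> where "\<epsilon> = snd (\<phi> (0, 1))"
  interpret s: additive "\<lambda>k. snd (\<phi> (0, k))"
    by standard (use snd_mult [of "(0, _)" "(0, _)"] in simp)
  have nat: "snd (\<phi> (0, int k)) = \<epsilon> * int k" for k
    by (induction k) (simp_all add: s.add s.zero \<epsilon>_def algebra_simps)
  have snd: "snd (\<phi> (v, k)) = \<epsilon> * k" for v k
  proof -
    have "snd (\<phi> (0, k)) = \<epsilon> * k"
      using nat by (cases k rule: int_cases2) (simp_all add: s.minus)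
    then show ?thesis
      using snd_mult [of "(v, 0)" "(0, k)"] snd0 by simp
  qed
  \<comment> \<open>A preimage of the generator shows that \<open>\<epsilon>\<close> divides
    1.\<close>
  obtain v k where "\<phi> (v, k) = (0, 1)"
    using surj by (metis surjD surj_pair)
  then have "\<epsilon> * k = 1"
    using snd [of v k] by simp
  then have \<epsilon>: "\<epsilon> = 1 \<or> \<epsilon> = -1"
    using zmult_eq_1_iff by blast
  define f where "f v = fst (\<phi> (v, 0))" for v
  have \<phi>f: "\<phi> (v, 0) = (f v, 0)" for v
    by (simp add: prod_eq_iff f_def snd0)
  have "f (x + y) = f x + f y" for x y
    using mult [of "(x, 0)" "(y, 0)"] by (simp add: \<phi>f)
  then have f: "Vector_Spaces.linear (*s) (*s) f"
    by (rule additive_rat_linear)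
  have "surj f"
  proof -
    have "\<exists>v. f v = u" for u
    proof -
    \<comment> \<open>Since \<open>\<epsilon>\<close> is nonzero, a preimage of
      \<open>(u, 0)\<close> has second coordinate 0, so it is already a preimage under
      \<open>f\<close>. For a square matrix, surjectivity then yields invertibility.\<close>
    obtain v k where vk: "\<phi> (v, k) = (u, 0)"
      using surj by (metis surjD surj_pair)
    then have "k = 0"
      using snd [of v k] \<epsilon> by auto
    then show ?thesis
      using vk \<phi>f [of v] by auto
    qed
    then show ?thesis
      unfolding surj_def by metis
  qed
  then have "invertible (matrix f)"
    by (simp add: invertible_right_inverse matrix_right_invertible_surjective matrix_works [OF f])
  moreover have "\<phi> (v, 0) = (matrix f *v v, 0)" for v
    by (simp add: \<phi>f matrix_works [OF f])
  moreover have "\<phi> (0, 1) = (fst (\<phi> (0, 1)), \<epsilon>)"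
    by (simp add: \<epsilon>_def)
  ultimately show thesis
    using that \<epsilon> snd by blast
qed

section \<open>Reidemeister numbers by sign and determinant\<close>

lemma reidemeister_number_infinite:
  assumes \<phi>: "\<phi> \<in> hom G G" and "infinite (f ` B)"
    and "\<And>x y. x \<in> B \<Longrightarrow> y \<in> B \<Longrightarrow> (x, y) \<in> twisted_conjugacy G \<phi> \<Longrightarrow> f x = f y"
  shows "reidemeister_number G \<phi> = \<infinity>"
proof -
  have "infinite (carrier G // twisted_conjugacy G \<phi>)"
    using G.equiv_twisted_conjugacy [OF \<phi>] assms(2,3)
    by (intro infinite_quotient [of B _ f]) (auto simp: equiv_def refl_on_def)
  then show ?thesis
    by (simp add: reidemeister_number_def reidemeister_classes_def)
qed

text \<open>The contributions \<open>j\<close> of \<open>g\<close> and \<open>- j\<close> of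
  \<open>\<phi> (inv g)\<close> to the second coordinate cancel, so \<open>snd\<close> is an
  invariant with infinitely many values.\<close>

lemma reidemeister_number_sign_pos:
  assumes \<phi>: "\<phi> \<in> hom G G" and snd: "\<And>v k. snd (\<phi> (v, k)) = k"
  shows "reidemeister_number G \<phi> = \<infinity>"
proof (rule reidemeister_number_infinite [OF \<phi>])
  show "infinite (snd ` (UNIV :: ((rat^'n) \<times> int) set))"
    by (simp add: infinite_UNIV_int)
  fix x y
  assume "(x, y) \<in> twisted_conjugacy G \<phi>"
  then obtain g where "y = g \<otimes>\<^bsub>G\<^esub> x \<otimes>\<^bsub>G\<^esub> \<phi> (inv\<^bsub>G\<^esub> g)"
    by (auto simp: twisted_conjugacy_def)
  moreover obtain a j where "g = (a, j)"
    by fastforce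
  moreover obtain u where "\<phi> (inv\<^bsub>G\<^esub> g) = (u, - j)"
    using snd \<open>g = (a, j)\<close> by (metis inv_G prod.collapse)
  ultimately show "snd x = snd y"
    by (cases x) simp
qed

text \<open>Twisting by \<open>(a, j)\<close> adds \<open>2 * j\<close> to the second coordinate.
  Hence parity is preserved, all heights of one parity are linked, and only elements with
  \<open>j = 0\<close> stay in a fibre; these act on the fibre over \<open>k\<close> by
  translations.\<close>

lemma twisted_conjugacy_sign_neg:
  assumes snd: "\<And>v k. snd (\<phi> (v, k)) = - k" and N: "\<And>v. \<phi> (v, 0) = (N *v v, 0)"
  shows "((v, k), (u, l)) \<in> twisted_conjugacy G \<phi> \<Longrightarrow> even (l - k)"
    and "((v, k), (u, k)) \<in> twisted_conjugacy G \<phi> \<longleftrightarrow>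
      (\<exists>a. u - v = (mat 1 - matrix (\<theta> k) ** N) *v a)"
    and "\<exists>u. ((v, k + 2 * j), (u, k)) \<in> twisted_conjugacy G \<phi>"
proof -
  define \<psi> where "\<psi> v k = fst (\<phi> (v, k))" for v k
  have \<phi>: "\<phi> (v, k) = (\<psi> v k, - k)" for v k
    by (simp add: prod_eq_iff \<psi>_def snd)
  \<comment> \<open>The inverse of \<open>(a, j)\<close> has second coordinate \<open>- j\<close>,
    which \<open>\<phi>\<close> turns back into \<open>j\<close>; hence the final
    \<open>+ j\<close>.\<close>
  have iff: "((v, k), (u, l)) \<in> twisted_conjugacy G \<phi> \<longleftrightarrow>
      (\<exists>a j. u = a + \<theta> j v + \<theta> (j + k) (\<psi> (\<theta> (- j) (- a)) (- j)) \<and> l = j + k + j)" for v k u l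
    by (simp add: twisted_conjugacy_def \<phi>)
  have \<psi>0: "\<psi> v 0 = N *v v" for v
    by (simp add: \<psi>_def N)
  have \<theta>N: "\<theta> k (N *v - a) = - ((matrix (\<theta> k) ** N) *v a)" for k a
    by (simp add: matrix_vector_mul_assoc [symmetric] matrix_works [OF \<theta>_linear]
        vec.linear_neg [OF \<theta>_linear] vec.neg)
  show "((v, k), (u, l)) \<in> twisted_conjugacy G \<phi> \<Longrightarrow> even (l - k)"
    by (auto simp: iff)
  show "((v, k), (u, k)) \<in> twisted_conjugacy G \<phi> \<longleftrightarrow>
      (\<exists>a. u - v = (mat 1 - matrix (\<theta> k) ** N) *v a)"
    by (auto simp: iff \<psi>0 \<theta>N matrix_vector_mult_diff_rdistrib algebra_simps)
  show "\<exists>u. ((v, k + 2 * j), (u, k)) \<in> twisted_conjugacy G \<phi>"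
    \<comment> \<open>A twisting element with second coordinate \<open>- j\<close> lowers
      \<open>k + 2 * j\<close> to \<open>k\<close>.\<close>
    unfolding iff by (intro exI [of _ "- j"] exI) (auto intro!: exI [of _ 0])
qed

text \<open>On the fibre over \<open>k\<close>, the functional that vanishes on the image of the
  singular matrix is constant on classes, yet it takes every rational value.\<close>

lemma reidemeister_number_sign_neg_singular:
  assumes \<phi>: "\<phi> \<in> hom G G" and snd: "\<And>v k. snd (\<phi> (v, k)) = - k"
    and N: "\<And>v. \<phi> (v, 0) = (N *v v, 0)"
    and det: "det (mat 1 - matrix (\<theta> k) ** N) = 0"
  shows "reidemeister_number G \<phi> = \<infinity>"
proof -
  obtain c where c: "c \<noteq> 0"
      "\<And>x. (\<Sum>i\<in>UNIV. c $ i * ((mat 1 - matrix (\<theta> k) ** N) *v x) $ i) = 0"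
    using singular_matrix_left_kernel [OF det] by metis
  define f where "f x = (\<Sum>i\<in>UNIV. c $ i * fst x $ i)" for x :: "(rat^'n) \<times> int"
  show ?thesis
  proof (rule reidemeister_number_infinite [OF \<phi>])
    obtain i where i: "c $ i \<noteq> 0"
      using c(1) by (auto simp: vec_eq_iff)
    have "q \<in> f ` range (\<lambda>v. (v, k))" for q
    proof -
      \<comment> \<open>A multiple of a coordinate vector on which \<open>c\<close> is nonzero,
        scaled so that the functional has value \<open>q\<close>.\<close>
      have "f (axis i (q / c $ i), k) = (\<Sum>j\<in>UNIV. if j = i then q else 0)"
        unfolding f_def using i by (intro sum.cong) (auto simp: axis_def)
      then have "f (axis i (q / c $ i), k) = q"
        by simp
      then show ?thesis
        by (metis rangeI image_eqI)
    qed
    then have "f ` range (\<lambda>v. (v, k)) = UNIV"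
      by blast
    then show "infinite (f ` range (\<lambda>v. (v, k)))"
      by (simp add: infinite_UNIV_char_0)
    fix x y
    assume "x \<in> range (\<lambda>v. (v, k))" "y \<in> range (\<lambda>v. (v, k))"
      and xy: "(x, y) \<in> twisted_conjugacy G \<phi>"
    then obtain v u where vu: "x = (v, k)" "y = (u, k)"
      by blast
    then obtain a where "u - v = (mat 1 - matrix (\<theta> k) ** N) *v a"
      using xy twisted_conjugacy_sign_neg(2) [of \<phi> N, OF snd N] by blast
    then have "(\<Sum>i\<in>UNIV. c $ i * (u - v) $ i) = 0"
      using c(2) by simp
    then show "f x = f y"
      by (simp add: f_def vu right_diff_distrib sum_subtractf)
  qed
qed

text \<open>Both translation maps are onto, so the fibres over 0 and 1 each lie in one class. Every
  element moves into one of these fibres, and parity keeps the two classes apart.\<close>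

lemma reidemeister_number_sign_neg_regular:
  assumes \<phi>: "\<phi> \<in> hom G G" and snd: "\<And>v k. snd (\<phi> (v, k)) = - k"
    and N: "\<And>v. \<phi> (v, 0) = (N *v v, 0)"
    and det: "det (mat 1 - N) \<noteq> 0" "det (mat 1 - M ** N) \<noteq> 0"
  shows "reidemeister_number G \<phi> = 2"
proof -
  let ?r = "twisted_conjugacy G \<phi>"
  note conj = twisted_conjugacy_sign_neg [of \<phi> N, OF snd N]
  have eq: "equiv UNIV ?r"
    using G.equiv_twisted_conjugacy [OF \<phi>] by simp
  have surj: "surj ((*v) (mat 1 - matrix (\<theta> k) ** N))" if "k \<in> {0, 1}" for k
    using that det M
    by (auto simp: invertible_det_nz [symmetric] invertible_right_inverse
        matrix_right_invertible_surjective)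
  have rep: "\<exists>k\<in>{0, 1}. ((0, k), x) \<in> ?r" for x
  proof -
    obtain v l where x: "x = (v, l)"
      by fastforce
    \<comment> \<open>First shift the height to its remainder modulo 2, then move within that fibre
      to the vector 0.\<close>
    have "l = l mod 2 + 2 * (l div 2)" and k: "l mod 2 \<in> {0, 1}"
      by auto
    then obtain u where "(x, (u, l mod 2)) \<in> ?r"
      using conj(3) x by metis
    moreover have "((0, l mod 2), (u, l mod 2)) \<in> ?r"
      using surj [OF k] by (metis conj(2) surjD)
    ultimately show ?thesis
      using eq k by (meson equivE symD transD)
  qed
  have "UNIV // ?r = {?r `` {(0, 0)}, ?r `` {(0, 1)}}"
  proof
    show "UNIV // ?r \<subseteq> {?r `` {(0, 0)}, ?r `` {(0, 1)}}"
    proof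
      fix X
      assume "X \<in> UNIV // ?r"
      then obtain x where X: "X = ?r `` {x}"
        by (auto simp: quotient_def)
      obtain k :: int where "k \<in> {0, 1}" "((0, k), x) \<in> ?r"
        using rep by blast
      then have "k \<in> {0, 1}" "X = ?r `` {(0, k)}"
        using equiv_class_eq [OF eq] X by simp_all
      then show "X \<in> {?r `` {(0, 0)}, ?r `` {(0, 1)}}"
        by blast
    qed
  qed (auto simp: quotient_def)
  moreover have "?r `` {(0, 0)} \<noteq> ?r `` {(0, 1)}"
    using eq_equiv_class [OF _ eq, of "(0, 0)" "(0, 1)"] conj(1) [of 0 0 0 1] by fastforce
  ultimately show ?thesis
    by (simp add: reidemeister_number_def reidemeister_classes_def numeral_eq_enat)
qed

section \<open>Correspondence between matrices \<open>N\<close> and automorphisms of sign -1\<close>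

text \<open>Apply \<open>\<phi>\<close> to the defining relation: the generator
  \<open>(0, 1)\<close> moves past \<open>(v, 0)\<close> at the cost of replacing \<open>v\<close>
  by \<open>M *v v\<close>.\<close>

lemma auto_sign_neg_intertwines:
  assumes \<phi>: "\<phi> \<in> hom G G" and N: "\<And>v. \<phi> (v, 0) = (N *v v, 0)" and w: "\<phi> (0, 1) = (w, -1)"
  shows "N = M ** N ** M"
proof -
  have mult: "\<phi> (x \<otimes>\<^bsub>G\<^esub> y) = \<phi> x \<otimes>\<^bsub>G\<^esub> \<phi> y" for x y
    using \<phi> by (auto intro: hom_mult)
  have "N *v v = M *v (N *v (M *v v))" for v
  proof -
    have "(0, 1) \<otimes>\<^bsub>G\<^esub> (v, 0) = (M *v v, 0) \<otimes>\<^bsub>G\<^esub> (0, 1)"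
      by (simp add: \<theta>_1)
    then have "\<phi> (0, 1) \<otimes>\<^bsub>G\<^esub> \<phi> (v, 0) = \<phi> (M *v v, 0) \<otimes>\<^bsub>G\<^esub> \<phi> (0, 1)"
      by (metis mult)
    \<comment> \<open>Comparing first coordinates, the unknown \<open>w\<close> cancels.\<close>
    then have "\<theta> (-1) (N *v v) = N *v (M *v v)"
      by (simp add: N w)
    then have "\<theta> 1 (\<theta> (-1) (N *v v)) = M *v (N *v (M *v v))"
      by (simp add: \<theta>_1)
    then show ?thesis
      by (simp add: \<theta>_comp)
  qed
  then show ?thesis
    by (metis matrix_eq matrix_vector_mul_assoc)
qed

text \<open>Multiplicativity amounts to \<open>comm\<close>. It is equivalent to the relation for
  all powers of \<open>M\<close>, which follows from the first power by induction and then for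
  negative exponents.\<close>

lemma sign_neg_auto:
  assumes inv: "invertible N" and NM: "N = M ** N ** M"
  shows "(\<lambda>(v, k). (N *v v, - k)) \<in> auto G"
proof -
  have N1: "N *v v = \<theta> 1 (N *v \<theta> 1 v)" for v
    by (metis NM \<theta>_1 matrix_vector_mul_assoc)
  have nat: "N *v v = \<theta> (int k) (N *v \<theta> (int k) v)" for k v
  proof (induction k arbitrary: v)
    case (Suc k)
    have "N *v v = \<theta> (int k) (\<theta> 1 (N *v \<theta> 1 (\<theta> (int k) v)))"
      using Suc N1 by metis
    then show ?case
      by (simp add: \<theta>_comp add.commute)
  qed simp
  have all: "N *v v = \<theta> k (N *v \<theta> k v)" for k v
  proof (cases k rule: int_cases2)
    case (nonneg n)
    then show ?thesis
      using nat by simp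
  next
    case (nonpos n)
    \<comment> \<open>Expand by the case of exponent \<open>n\<close> at the vector
      \<open>\<theta> k v\<close>; as \<open>k = - int n\<close>, the actions cancel in
      pairs.\<close>
    have "\<theta> k (N *v \<theta> k v) = \<theta> k (\<theta> (int n) (N *v \<theta> (int n) (\<theta> k v)))"
      using nat by metis
    then show ?thesis
      by (simp add: \<theta>_comp nonpos)
  qed
  have comm: "N *v \<theta> k v = \<theta> (- k) (N *v v)" for k v
    using all [of v k] by (simp add: \<theta>_comp)
  have "bij ((*v) N)"
    using inv by (metis invertible_eq_bij)
  then have "bij (map_prod ((*v) N) (uminus :: int \<Rightarrow> int))"
    by (simp add: bij_def prod.inj_map map_prod_surj)
  moreover have "map_prod ((*v) N) uminus = (\<lambda>(v, k). (N *v v, - k))"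
    by (auto simp: fun_eq_iff)
  ultimately have "bij (\<lambda>(v, k :: int). (N *v v, - k))"
    by metis
  then show ?thesis
    by (auto simp: auto_def hom_def Bij_def vec.add comm)
qed

section \<open>Assembling the spectrum\<close>

lemma infinity_in_spectrum: "\<infinity> \<in> reidemeister_spectrum G"
proof -
  \<comment> \<open>The identity has sign 1, so it realizes the infinite value for every
    \<open>M\<close>.\<close>
  have id: "(\<lambda>x. x) \<in> auto G"
    using G.id_in_auto by (simp add: restrict_UNIV)
  then have "reidemeister_number G (\<lambda>x. x) = \<infinity>"
    by (intro reidemeister_number_sign_pos) (auto simp: auto_def)
  then show ?thesis
    using id by (force simp: reidemeister_spectrum_def)
qed

lemma reidemeister_number_cases:
  assumes "\<phi> \<in> auto G" and "reidemeister_number G \<phi> \<noteq> \<infinity>"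
  shows "reidemeister_number G \<phi> = 2 \<and>
    (\<exists>N. invertible N \<and> N = M ** N ** M \<and> det (mat 1 - N) \<noteq> 0 \<and> det (mat 1 - M ** N) \<noteq> 0)"
proof -
  obtain N w \<epsilon> where inv: "invertible N" and \<epsilon>: "\<epsilon> = 1 \<or> \<epsilon> = -1"
    and snd: "\<And>v k. snd (\<phi> (v, k)) = \<epsilon> * k" and N: "\<And>v. \<phi> (v, 0) = (N *v v, 0)"
    and w: "\<phi> (0, 1) = (w, \<epsilon>)"
    using auto_shape [OF assms(1)] by metis
  have \<phi>: "\<phi> \<in> hom G G"
    using assms(1) by (simp add: auto_def)
  have "\<epsilon> = -1"
    using reidemeister_number_sign_pos [OF \<phi>] snd \<epsilon> assms(2) by auto
  then have neg: "snd (\<phi> (v, k)) = - k" for v k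
    by (simp add: snd)
  have "det (mat 1 - N) \<noteq> 0" "det (mat 1 - M ** N) \<noteq> 0"
    \<comment> \<open>The fibres over 0 and 1, where \<open>matrix (\<theta> k)\<close> is the
      identity and \<open>M\<close>, yield the two determinant conditions.\<close>
    using reidemeister_number_sign_neg_singular [OF \<phi> neg N, of 0]
      reidemeister_number_sign_neg_singular [OF \<phi> neg N, of 1] assms(2) M by auto
  moreover have "N = M ** N ** M"
    using auto_sign_neg_intertwines [OF \<phi> N] w \<open>\<epsilon> = -1\<close> by blast
  ultimately show ?thesis
    using inv reidemeister_number_sign_neg_regular [OF \<phi> neg N] by blast
qed

lemma two_in_spectrum:
  assumes "invertible N" "N = M ** N ** M" "det (mat 1 - N) \<noteq> 0" "det (mat 1 - M ** N) \<noteq> 0"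
  shows "2 \<in> reidemeister_spectrum G"
proof -
  let ?\<phi> = "\<lambda>(v, k). (N *v v, - k)"
  have "?\<phi> \<in> auto G"
    by (rule sign_neg_auto [OF assms(1,2)])
  moreover from this have "reidemeister_number G ?\<phi> = 2"
    using assms(3,4) by (intro reidemeister_number_sign_neg_regular [of _ N]) (auto simp: auto_def)
  ultimately show ?thesis
    unfolding reidemeister_spectrum_def by (intro CollectI exI [of _ ?\<phi>]) simp
qed

lemma reidemeister_spectrum_eq:
  "reidemeister_spectrum G =
    (if \<exists>N. invertible N \<and> N = M ** N ** M \<and> det (mat 1 - N) \<noteq> 0 \<and> det (mat 1 - M ** N) \<noteq> 0
     then {2} \<union> {\<infinity>} else {\<infinity>})" (is "_ = (if ?ex then _ else _)")
proof -
  have "x = \<infinity> \<or> x = 2 \<and> ?ex" if "x \<in> reidemeister_spectrum G" for x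
    using that reidemeister_number_cases by (auto simp: reidemeister_spectrum_def)
  moreover have "2 \<in> reidemeister_spectrum G" if ?ex
    using that two_in_spectrum by blast
  ultimately show ?thesis
    using infinity_in_spectrum by (cases ?ex) auto
qed

end

theorem proposition3p2:
  fixes \<theta> :: "int \<Rightarrow> rat ^ 2 \<Rightarrow> rat ^ 2" and M :: "rat ^ 2 ^ 2"
  assumes "\<theta> \<in> hom integer_group (AutoGroup additive_group)"
    and "M = matrix (\<theta> 1)"
  shows "(reidemeister_spectrum (semidirect_product additive_group integer_group \<theta>) = {\<infinity>} \<or>
          reidemeister_spectrum (semidirect_product additive_group integer_group \<theta>) = {2} \<union> {\<infinity>}) \<and>
         ((\<nexists>N :: rat ^ 2 ^ 2. invertible N \<and> N = M ** N ** M \<and>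
              det (mat 1 - N) \<noteq> 0 \<and> det (mat 1 - M ** N) \<noteq> 0) \<longrightarrow>
          reidemeister_spectrum (semidirect_product additive_group integer_group \<theta>) = {\<infinity>}) \<and>
         ((\<exists>N :: rat ^ 2 ^ 2. invertible N \<and> N = M ** N ** M \<and>
              det (mat 1 - N) \<noteq> 0 \<and> det (mat 1 - M ** N) \<noteq> 0) \<longrightarrow>
          reidemeister_spectrum (semidirect_product additive_group integer_group \<theta>) = {2} \<union> {\<infinity>})"
proof -
  interpret rat_by_int \<theta> M
    using assms by unfold_locales
  show ?thesis
    unfolding reidemeister_spectrum_eq by auto
qed

end
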